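(* Let $\mathcal S$ be a symmetric operator and $\mathcal A$ a skew-symmetric operator, both allowed to depend on the time variable $t$, let $G$ be a positive function, let $f(x,t)$ be a reasonable function, and set $$H(t)=(f,f),\qquad D(t)=(\mathcal Sf,f),\qquad \mathcal S_t=\partial_t\mathcal S,\qquad N(t)=\frac{D(t)}{H(t)} .$$ Then $$\partial_t^2H=2\,\partial_t\operatorname{Re}\left(\partial_tf-\mathcal Sf-\mathcal Af,f\right)+2\left(\mathcal S_tf+[\mathcal S,\mathcal A]f,f\right)+\|\partial_tf-\mathcal Af+\mathcal Sf\|^2-\|\partial_tf-\mathcal Af-\mathcal Sf\|^2$$ and $$\dot N(t)\ge\frac{\left(\mathcal S_tf+[\mathcal S,\mathcal A]f,f\right)}{H}-\frac{\|\partial_tf-\mathcal Af-\mathcal Sf\|^2}{2H}.$$ Moreover, if $$|\partial_tf-\mathcal Af-\mathcal Sf|\le M_1|f|+G\ \text{ in }\mathbb R^n\times[0,1],\qquad \mathcal S_t+[\mathcal S,\mathcal A]\ge-M_0,$$ and $$M_2=\sup_{t\in[0,1]}\|G(t)\|/\|f(t)\|$$ is finite, then $H(t)$ is "logarithmically convex" in $[0,1]$ and there is a universal constant $C$ such that $$H(t)\le e^{C(M_0+M_1+M_2+M_1^2+M_2^2)}H(0)^{1-t}H(1)^t,\qquad\text{when }0\le t\le1 .$$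
   Context: $(f,g)=\int_{\mathbb R^n}f\overline g\,dx$ and $\|f\|^2=(f,f)$; symmetry and skew-symmetry are with respect to this inner product in the space variable $x\in\mathbb R^n$. $f(t)=f(\cdot,t)$, $G(t)=G(\cdot,t)$; a dot denotes $d/dt$; $[\mathcal S,\mathcal A]=\mathcal S\mathcal A-\mathcal A\mathcal S$; the inequality $\mathcal S_t+[\mathcal S,\mathcal A]\ge-M_0$ is an inequality between operators. The result is a formal (abstract) one: no precise regularity class is specified, and "reasonable function" means that the quantities involved are finite and the formal calculations (differentiating $H$ and $D$ in $t$ and using the symmetry of $\mathcal S$ and skew-symmetry of $\mathcal A$) are correct for $f$. The quotation marks around "logarithmically convex" indicate convexity of $\log H$ up to a bounded error, as expressed by the last inequality. *)

theory Defs
  imports "HOL-Analysis.Analysis"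
begin

text \<open>
  Points of \<open>n\<close>-dimensional space are the extensional functions \<open>{..<n} \<rightarrow> real\<close>. The dimension is a
  term rather than a type, so that a constant quantified outside \<open>n\<close> does not depend on \<open>n\<close>.
\<close>

type_synonym cfun = "(nat \<Rightarrow> real) \<Rightarrow> complex"

definition Leb :: "nat \<Rightarrow> (nat \<Rightarrow> real) measure" where
  "Leb n = completion (Pi\<^sub>M {..<n} (\<lambda>_. lborel))"

definition L2 :: "nat \<Rightarrow> cfun set" where
  "L2 n = {u \<in> borel_measurable (Leb n). integrable (Leb n) (\<lambda>x. (cmod (u x))\<^sup>2)}"

definition ip :: "nat \<Rightarrow> cfun \<Rightarrow> cfun \<Rightarrow> complex" where
  "ip n u v = (LINT x|Leb n. u x * cnj (v x))"

definition l2norm :: "nat \<Rightarrow> cfun \<Rightarrow> real" where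
  "l2norm n u = sqrt (Re (ip n u u))"

text \<open>
  Operators may be unbounded. Each is linear on its own domain, which does not depend on time;
  values are identified up to null sets.
\<close>

definition linear_subspace :: "nat \<Rightarrow> cfun set \<Rightarrow> bool" where
  "linear_subspace n V \<longleftrightarrow> V \<subseteq> L2 n \<and> (\<lambda>x. 0) \<in> V \<and>
     (\<forall>a b. \<forall>u\<in>V. \<forall>v\<in>V. (\<lambda>x. a * u x + b * v x) \<in> V)"

definition linear_operator :: "nat \<Rightarrow> cfun set \<Rightarrow> (cfun \<Rightarrow> cfun) \<Rightarrow> bool" where
  "linear_operator n V T \<longleftrightarrow> linear_subspace n V \<and> (\<forall>u\<in>V. T u \<in> L2 n) \<and>
     (\<forall>a b. \<forall>u\<in>V. \<forall>v\<in>V. AE x in Leb n.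
        T (\<lambda>y. a * u y + b * v y) x = a * T u x + b * T v x)"

definition symmetric_operator :: "nat \<Rightarrow> cfun set \<Rightarrow> (cfun \<Rightarrow> cfun) \<Rightarrow> bool" where
  "symmetric_operator n V T \<longleftrightarrow> linear_operator n V T \<and>
     (\<forall>u\<in>V. \<forall>v\<in>V. ip n (T u) v = ip n u (T v))"

definition skew_symmetric_operator :: "nat \<Rightarrow> cfun set \<Rightarrow> (cfun \<Rightarrow> cfun) \<Rightarrow> bool" where
  "skew_symmetric_operator n V T \<longleftrightarrow> linear_operator n V T \<and>
     (\<forall>u\<in>V. \<forall>v\<in>V. ip n (T u) v = - ip n u (T v))"

definition commutator :: "(cfun \<Rightarrow> cfun) \<Rightarrow> (cfun \<Rightarrow> cfun) \<Rightarrow> cfun \<Rightarrow> cfun" where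
  "commutator P Q u = (\<lambda>x. P (Q u) x - Q (P u) x)"

text \<open>
  \<open>ddt I F t\<close> is the time derivative relative to the time interval \<open>I\<close> (one-sided at its end
  points), and \<open>pdt I f t\<close> is the partial time derivative of a function of time and space. The
  operator \<open>\<partial>\<^sub>t S\<close> sends \<open>u\<close> to \<open>pdt I (\<lambda>s. S s u) t\<close>, the function \<open>u\<close> being kept fixed.
\<close>

definition ddt :: "real set \<Rightarrow> (real \<Rightarrow> 'a::real_normed_vector) \<Rightarrow> real \<Rightarrow> 'a" where
  "ddt I F t = vector_derivative F (at t within I)"

definition pdt :: "real set \<Rightarrow> (real \<Rightarrow> cfun) \<Rightarrow> real \<Rightarrow> cfun" where
  "pdt I f t = (\<lambda>x. ddt I (\<lambda>s. f s x) t)"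

definition pdt_exists :: "nat \<Rightarrow> real set \<Rightarrow> (real \<Rightarrow> cfun) \<Rightarrow> real \<Rightarrow> bool" where
  "pdt_exists n I f t \<longleftrightarrow> (AE x in Leb n. (\<lambda>s. f s x) differentiable (at t within I))"

definition St_comm ::
  "real set \<Rightarrow> (real \<Rightarrow> cfun \<Rightarrow> cfun) \<Rightarrow> (real \<Rightarrow> cfun \<Rightarrow> cfun) \<Rightarrow> real \<Rightarrow> cfun \<Rightarrow> cfun" where
  "St_comm I S A t u = (\<lambda>x. pdt I (\<lambda>s. S s u) t x + commutator (S t) (A t) u x)"

definition St_comm_dom ::
  "nat \<Rightarrow> real set \<Rightarrow> cfun set \<Rightarrow> cfun set \<Rightarrow> (real \<Rightarrow> cfun \<Rightarrow> cfun) \<Rightarrow> (real \<Rightarrow> cfun \<Rightarrow> cfun)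
     \<Rightarrow> real \<Rightarrow> cfun set" where
  "St_comm_dom n I DS DA S A t =
     {u \<in> DS \<inter> DA. A t u \<in> DS \<and> S t u \<in> DA \<and>
        pdt_exists n I (\<lambda>s. S s u) t \<and> pdt I (\<lambda>s. S s u) t \<in> L2 n}"

definition diff_under_integral :: "nat \<Rightarrow> real set \<Rightarrow> (real \<Rightarrow> cfun) \<Rightarrow> real \<Rightarrow> bool" where
  "diff_under_integral n I F t \<longleftrightarrow>
     ((\<lambda>s. LINT x|Leb n. F s x) has_vector_derivative (LINT x|Leb n. pdt I F t x)) (at t within I)"

text \<open>
  The functions for which the formal calculations are legitimate: all terms involved are square
  integrable, \<open>\<partial>\<^sub>t(S f) = S\<^sub>t f + S \<partial>\<^sub>t f\<close>, and the integrals \<open>(f, f)\<close> and \<open>(S f, f)\<close> may be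
  differentiated in time under the integral sign.
\<close>

definition reasonable ::
  "nat \<Rightarrow> real set \<Rightarrow> cfun set \<Rightarrow> cfun set \<Rightarrow> (real \<Rightarrow> cfun \<Rightarrow> cfun) \<Rightarrow> (real \<Rightarrow> cfun \<Rightarrow> cfun)
     \<Rightarrow> (real \<Rightarrow> cfun) \<Rightarrow> bool" where
  "reasonable n I DS DA S A f \<longleftrightarrow> (\<forall>t\<in>I.
     f t \<in> St_comm_dom n I DS DA S A t \<and>
     pdt_exists n I f t \<and> pdt I f t \<in> DS \<and>
     (AE x in Leb n. ((\<lambda>s. S s (f s) x) has_vector_derivative
        pdt I (\<lambda>s. S s (f t)) t x + S t (pdt I f t) x) (at t within I)) \<and>
     diff_under_integral n I (\<lambda>s x. f s x * cnj (f s x)) t \<and>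
     diff_under_integral n I (\<lambda>s x. S s (f s) x * cnj (f s x)) t)"

text \<open>
  \<open>(f, f)\<close> and \<open>(S f, f)\<close> are real numbers (the latter by the symmetry of \<open>S\<close>), so that taking real
  parts only changes the type.
\<close>

definition HH :: "nat \<Rightarrow> (real \<Rightarrow> cfun) \<Rightarrow> real \<Rightarrow> real" where
  "HH n f t = Re (ip n (f t) (f t))"

definition DD :: "nat \<Rightarrow> (real \<Rightarrow> cfun \<Rightarrow> cfun) \<Rightarrow> (real \<Rightarrow> cfun) \<Rightarrow> real \<Rightarrow> real" where
  "DD n S f t = Re (ip n (S t (f t)) (f t))"

definition NN :: "nat \<Rightarrow> (real \<Rightarrow> cfun \<Rightarrow> cfun) \<Rightarrow> (real \<Rightarrow> cfun) \<Rightarrow> real \<Rightarrow> real" where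
  "NN n S f t = DD n S f t / HH n f t"

definition res_minus ::
  "real set \<Rightarrow> (real \<Rightarrow> cfun \<Rightarrow> cfun) \<Rightarrow> (real \<Rightarrow> cfun \<Rightarrow> cfun) \<Rightarrow> (real \<Rightarrow> cfun) \<Rightarrow> real \<Rightarrow> cfun" where
  "res_minus I S A f t = (\<lambda>x. pdt I f t x - A t (f t) x - S t (f t) x)"

definition res_plus ::
  "real set \<Rightarrow> (real \<Rightarrow> cfun \<Rightarrow> cfun) \<Rightarrow> (real \<Rightarrow> cfun \<Rightarrow> cfun) \<Rightarrow> (real \<Rightarrow> cfun) \<Rightarrow> real \<Rightarrow> cfun" where
  "res_plus I S A f t = (\<lambda>x. pdt I f t x - A t (f t) x + S t (f t) x)"

text \<open>\<open>S\<^sub>t + [S, A] \<ge> - M0\<close> as quadratic forms, on the natural domain of the left-hand side.\<close>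

definition St_comm_bounded_below ::
  "nat \<Rightarrow> real set \<Rightarrow> cfun set \<Rightarrow> cfun set \<Rightarrow> (real \<Rightarrow> cfun \<Rightarrow> cfun) \<Rightarrow> (real \<Rightarrow> cfun \<Rightarrow> cfun)
     \<Rightarrow> real \<Rightarrow> real \<Rightarrow> bool" where
  "St_comm_bounded_below n I DS DA S A M0 t \<longleftrightarrow>
     (\<forall>u \<in> St_comm_dom n I DS DA S A t. Re (ip n (St_comm I S A t u) u) \<ge> - M0 * (l2norm n u)\<^sup>2)"

end

theory Submission
  imports Defs
begin

text \<open>
  Since \<open>Re (A f, f) = 0\<close>, the first derivative is \<open>H' = 2 Re (\<partial>\<^sub>t f - S f - A f, f) + 2 D\<close>, and
  polarization turns the mixed terms of \<open>D'\<close> into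
  \<open>D' = (S\<^sub>t f + [S, A] f, f) + (\<parallel>\<partial>\<^sub>t f - A f + S f\<parallel>\<^sup>2 - \<parallel>\<partial>\<^sub>t f - A f - S f\<parallel>\<^sup>2) / 2\<close>.
  The Cauchy--Schwarz inequality for \<open>\<partial>\<^sub>t f - A f + S f\<close> and \<open>f\<close> then bounds \<open>N'\<close> from below.
  Under the last hypotheses, \<open>N' \<ge> -K\<close> and \<open>(log H)'\<close> differs from \<open>2 N\<close> by at most \<open>2 E\<close>, so
  \<open>(log H)'\<close> is increasing up to a bounded error; the mean value theorem on \<open>[0, t]\<close> and on
  \<open>[t, 1]\<close> converts this into convexity of \<open>log H\<close> up to a bounded error.
\<close>

section \<open>Square integrable functions\<close>

text \<open>For each Borel set \<open>B\<close>, the points where \<open>f x\<close> and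
  \<open>g x\<close> disagree about membership in \<open>B\<close> form a subset of a null set,
  which the completion makes measurable.\<close>

lemma borel_measurable_completion_AE_cong:
  assumes f: "f \<in> borel_measurable (completion M)" and eq: "AE x in completion M. f x = g x"
  shows "g \<in> borel_measurable (completion M)"
proof (rule measurableI)
  fix B :: "'b set" assume B: "B \<in> sets borel"
  have "AE x in M. \<not> ((f x \<in> B) \<noteq> (g x \<in> B))"
    using eq by (auto simp: AE_completion_iff elim: eventually_mono)
  then have [measurable]: "Measurable.pred (completion M) (\<lambda>x. (f x \<in> B) \<noteq> (g x \<in> B))"
    by (rule sets_completion_AE)
  have [measurable]: "Measurable.pred (completion M) (\<lambda>x. f x \<in> B)"
    using f B by measurable
  \<comment> \<open>For truth values \<open>\<noteq>\<close> is exclusive or, so combining the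
    membership of \<open>f x\<close> with the disagreement set returns the membership of
    \<open>g x\<close>.\<close>
  have "Measurable.pred (completion M) (\<lambda>x. (f x \<in> B) \<noteq> ((f x \<in> B) \<noteq> (g x \<in> B)))"
    by measurable
  moreover have "((f x \<in> B) \<noteq> ((f x \<in> B) \<noteq> (g x \<in> B))) = (g x \<in> B)" for x
    by blast
  ultimately have "Measurable.pred (completion M) (\<lambda>x. g x \<in> B)"
    by simp
  then show "g -` B \<inter> space (completion M) \<in> sets (completion M)"
    by (simp add: pred_def vimage_def Int_def conj_commute)
qed simp

text \<open>Meant for a pointwise time derivative \<open>g\<close> that is known only almost
  everywhere; its measurability is inherited from \<open>f\<close>.\<close>

lemma integral_Leb_cong_AE:
  fixes f g :: cfun
  assumes f: "f \<in> borel_measurable (Leb n)" and eq: "AE x in Leb n. f x = g x"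
  shows "integral\<^sup>L (Leb n) g = integral\<^sup>L (Leb n) f"
proof -
  have "g \<in> borel_measurable (Leb n)"
    using f eq unfolding Leb_def by (rule borel_measurable_completion_AE_cong)
  then show ?thesis
    using integral_cong_AE[OF f _ eq] by simp
qed

lemma L2_measurable: "u \<in> L2 n \<Longrightarrow> u \<in> borel_measurable (Leb n)"
  by (simp add: L2_def)

lemma L2_integrable_square: "u \<in> L2 n \<Longrightarrow> integrable (Leb n) (\<lambda>x. (cmod (u x))\<^sup>2)"
  by (simp add: L2_def)

lemma borel_measurable_cnj [measurable (raw)]:
  "f \<in> borel_measurable M \<Longrightarrow> (\<lambda>x. cnj (f x)) \<in> borel_measurable M"
  by (rule borel_measurable_continuous_on[OF continuous_on_cnj[OF continuous_on_id]])

lemma L2_integrable_mult: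
  assumes u: "u \<in> L2 n" and v: "v \<in> L2 n"
  shows "integrable (Leb n) (\<lambda>x. u x * cnj (v x))"
proof (rule Bochner_Integration.integrable_bound)
  show "integrable (Leb n) (\<lambda>x. (cmod (u x))\<^sup>2 + (cmod (v x))\<^sup>2)"
    using u v by (simp add: L2_integrable_square)
  show "(\<lambda>x. u x * cnj (v x)) \<in> borel_measurable (Leb n)"
    using u[THEN L2_measurable] v[THEN L2_measurable] by measurable
  have "a * b \<le> a\<^sup>2 + b\<^sup>2" if "0 \<le> a" "0 \<le> b" for a b :: real
    using sum_squares_bound[of a b] mult_nonneg_nonneg[OF that] by linarith
  then show "AE x in Leb n. norm (u x * cnj (v x)) \<le> norm ((cmod (u x))\<^sup>2 + (cmod (v x))\<^sup>2)"
    by (simp add: norm_mult)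
qed

lemma L2_add:
  assumes u: "u \<in> L2 n" and v: "v \<in> L2 n"
  shows "(\<lambda>x. u x + v x) \<in> L2 n"
proof -
  have "integrable (Leb n) (\<lambda>x. (cmod (u x + v x))\<^sup>2)"
  proof (rule Bochner_Integration.integrable_bound)
    show "integrable (Leb n) (\<lambda>x. 2 * (cmod (u x))\<^sup>2 + 2 * (cmod (v x))\<^sup>2)"
      using u v by (simp add: L2_integrable_square)
    show "(\<lambda>x. (cmod (u x + v x))\<^sup>2) \<in> borel_measurable (Leb n)"
      using u[THEN L2_measurable] v[THEN L2_measurable] by measurable
    have "(cmod (a + b))\<^sup>2 \<le> 2 * (cmod a)\<^sup>2 + 2 * (cmod b)\<^sup>2" for a b
    proof -
      have "(cmod (a + b))\<^sup>2 \<le> (cmod a + cmod b)\<^sup>2"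
        by (simp add: norm_triangle_ineq power_mono)
      also have "\<dots> \<le> 2 * (cmod a)\<^sup>2 + 2 * (cmod b)\<^sup>2"
        using sum_squares_bound[of "cmod a" "cmod b"] by (simp add: power2_sum)
      finally show ?thesis .
    qed
    then show "AE x in Leb n. norm ((cmod (u x + v x))\<^sup>2)
        \<le> norm (2 * (cmod (u x))\<^sup>2 + 2 * (cmod (v x))\<^sup>2)"
      by simp
  qed
  moreover have "(\<lambda>x. u x + v x) \<in> borel_measurable (Leb n)"
    using u[THEN L2_measurable] v[THEN L2_measurable] by measurable
  ultimately show ?thesis by (simp add: L2_def)
qed

lemma L2_cmult: "u \<in> L2 n \<Longrightarrow> (\<lambda>x. c * u x) \<in> L2 n"
  by (auto simp: L2_def norm_mult power_mult_distrib)

lemma L2_diff: "u \<in> L2 n \<Longrightarrow> v \<in> L2 n \<Longrightarrow> (\<lambda>x. u x - v x) \<in> L2 n"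
  using L2_add[OF _ L2_cmult[of v n "-1"], of u] by simp

lemmas L2_intros = L2_add L2_diff L2_cmult

section \<open>The inner product and the Cauchy-Schwarz inequality\<close>

lemma ip_commute: "ip n v u = cnj (ip n u v)"
  using Bochner_Integration.integral_cnj[of "Leb n" "\<lambda>x. u x * cnj (v x)"]
  by (simp add: ip_def mult.commute del: Bochner_Integration.integral_cnj)

lemma Re_ip_commute: "Re (ip n v u) = Re (ip n u v)"
  by (simp add: ip_commute[of n v u])

lemma ip_add_left:
  "u \<in> L2 n \<Longrightarrow> v \<in> L2 n \<Longrightarrow> w \<in> L2 n \<Longrightarrow> ip n (\<lambda>x. u x + v x) w = ip n u w + ip n v w"
  by (simp add: ip_def distrib_right L2_integrable_mult)

lemma ip_diff_left:
  "u \<in> L2 n \<Longrightarrow> v \<in> L2 n \<Longrightarrow> w \<in> L2 n \<Longrightarrow> ip n (\<lambda>x. u x - v x) w = ip n u w - ip n v w"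
  by (simp add: ip_def left_diff_distrib L2_integrable_mult)

lemma ip_cmult_left: "ip n (\<lambda>x. c * u x) w = c * ip n u w"
  by (simp add: ip_def mult.assoc)

lemma ip_add_right:
  "u \<in> L2 n \<Longrightarrow> v \<in> L2 n \<Longrightarrow> w \<in> L2 n \<Longrightarrow> ip n w (\<lambda>x. u x + v x) = ip n w u + ip n w v"
  by (simp add: ip_commute[of n w] ip_add_left)

lemma ip_diff_right:
  "u \<in> L2 n \<Longrightarrow> v \<in> L2 n \<Longrightarrow> w \<in> L2 n \<Longrightarrow> ip n w (\<lambda>x. u x - v x) = ip n w u - ip n w v"
  by (simp add: ip_commute[of n w] ip_diff_left)

lemma ip_cmult_right: "ip n w (\<lambda>x. c * u x) = cnj c * ip n w u"
  by (simp add: ip_commute[of n w] ip_cmult_left)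

lemmas ip_simps = ip_add_left ip_diff_left ip_cmult_left ip_add_right ip_diff_right ip_cmult_right

lemma ip_self: "ip n u u = complex_of_real (LINT x|Leb n. (cmod (u x))\<^sup>2)"
  by (simp add: ip_def complex_norm_square[symmetric] del: of_real_power)

lemma Re_ip_self: "Re (ip n u u) = (LINT x|Leb n. (cmod (u x))\<^sup>2)"
  by (simp add: ip_self)

lemma l2norm_square: "(l2norm n u)\<^sup>2 = Re (ip n u u)"
  by (simp add: l2norm_def Re_ip_self)

lemma l2norm_nonneg: "0 \<le> l2norm n u"
  by (simp add: l2norm_def Re_ip_self)

text \<open>The square of the norm of \<open>u - c v\<close> is a nonnegative quadratic polynomial
  in the real variable \<open>c\<close>.\<close>

lemma Re_ip_Cauchy_Schwarz:
  assumes u: "u \<in> L2 n" and v: "v \<in> L2 n"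
  shows "(Re (ip n u v))\<^sup>2 \<le> (l2norm n u)\<^sup>2 * (l2norm n v)\<^sup>2"
proof -
  define b where "b = Re (ip n u v)"
  define d where "d = (l2norm n v)\<^sup>2"
  have quad: "0 \<le> (l2norm n u)\<^sup>2 - 2 * c * b + c\<^sup>2 * d" for c
  proof -
    have "(l2norm n (\<lambda>x. u x - complex_of_real c * v x))\<^sup>2 = (l2norm n u)\<^sup>2 - 2 * c * b + c\<^sup>2 * d"
      using u v Re_ip_commute[of n v u]
      unfolding l2norm_square b_def d_def
      by (simp add: ip_simps L2_intros power2_eq_square algebra_simps)
    then show ?thesis by (metis zero_le_power2)
  qed
  show ?thesis
  proof (cases "d = 0")
    case True
    have "b = 0"
    proof (rule ccontr)
      assume "b \<noteq> 0"
      \<comment> \<open>With \<open>d = 0\<close> the polynomial is affine in \<open>c\<close>; this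
        \<open>c\<close> gives it the value -1.\<close>
      then show False
        using quad[of "((l2norm n u)\<^sup>2 + 1) / (2 * b)"] True by (simp add: field_simps)
    qed
    then show ?thesis by (simp add: b_def)
  next
    case False
    then have "0 < d" by (simp add: d_def)
    \<comment> \<open>The value \<open>b / d\<close> minimizes the quadratic polynomial.\<close>
    then have "b\<^sup>2 \<le> (l2norm n u)\<^sup>2 * d"
      using quad[of "b / d"] by (simp add: field_simps power2_eq_square)
    then show ?thesis by (simp add: b_def d_def)
  qed
qed

section \<open>Derivatives relative to an interval\<close>

text \<open>A connected set with two distinct points has no isolated point. This makes derivatives
  relative to \<open>I\<close> unique, also at its end points.\<close>

lemma at_within_interval_neq_bot:
  fixes I :: "real set"
  assumes "is_interval I" "a \<in> I" "b \<in> I" "a < b" "t \<in> I"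
  shows "at t within I \<noteq> bot"
proof -
  have "t islimpt I"
    using assms by (intro connected_imp_perfect) (auto simp: is_interval_connected)
  then show ?thesis by (simp add: trivial_limit_within)
qed

lemma derivative_ge_imp_increment_ge:
  fixes g :: "real \<Rightarrow> real"
  assumes "a \<le> b" "{a..b} \<subseteq> T"
    and "\<And>t. t \<in> {a..b} \<Longrightarrow> (g has_vector_derivative g' t) (at t within T)"
    and "\<And>t. t \<in> {a..b} \<Longrightarrow> - K \<le> g' t"
  shows "g a - K * (b - a) \<le> g b"
proof -
  have "\<exists>t\<in>{a..b}. g b - g a = (b - a) * g' t"
    using assms(1,2) has_vector_derivative_within_subset[OF assms(3)]
    by (intro mvt_very_simple) (auto simp: has_vector_derivative_def)
  then obtain t where "t \<in> {a..b}" "g b - g a = (b - a) * g' t" by blast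
  moreover from this have "(b - a) * (- K) \<le> (b - a) * g' t"
    using assms(1,4) by (intro mult_left_mono) auto
  ultimately show ?thesis by (simp add: algebra_simps)
qed

text \<open>To be used with \<open>L\<close> = log H and \<open>N\<close> the quotient D/H. The mean
  value theorem gives slopes \<open>L' c\<close> and \<open>L' d\<close> with
  \<open>c \<le> t \<le> d\<close>, and the defect from convexity at \<open>t\<close> equals
  \<open>t * (1 - t) * (L' c - L' d)\<close>. The slopes are compared through \<open>N\<close>,
  which decreases by at most \<open>K\<close> from \<open>c\<close> to \<open>d\<close>.\<close>

lemma almost_convex_bound:
  fixes L N :: "real \<Rightarrow> real"
  assumes L: "\<And>t. t \<in> {0..1} \<Longrightarrow> (L has_vector_derivative L' t) (at t within T)"
    and T: "{0..1} \<subseteq> T"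
    and N: "\<And>t. t \<in> {0..1} \<Longrightarrow> (N has_vector_derivative N' t) (at t within T)"
    and LN: "\<And>t. t \<in> {0..1} \<Longrightarrow> \<bar>L' t - 2 * N t\<bar> \<le> 2 * E"
    and K: "\<And>t. t \<in> {0..1} \<Longrightarrow> - K \<le> N' t" "0 \<le> K"
    and t: "t \<in> {0..1}"
  shows "L t \<le> (1 - t) * L 0 + t * L 1 + (E + K)"
proof -
  have mvt: "\<exists>c\<in>{a..b}. L b - L a = (b - a) * L' c" if "a \<le> b" "{a..b} \<subseteq> {0..1}" for a b
  proof (rule mvt_very_simple[OF that(1)])
    fix c assume "a \<le> c" "c \<le> b"
    then have "(L has_vector_derivative L' c) (at c within {a..b})"
      using that(2) T by (intro has_vector_derivative_within_subset[OF L]) auto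
    then show "(L has_derivative (\<lambda>h. h * L' c)) (at c within {a..b})"
      by (simp add: has_vector_derivative_def)
  qed
  obtain c where c: "c \<in> {0..t}" "L t - L 0 = t * L' c"
    using mvt[of 0 t] t by auto
  obtain d where d: "d \<in> {t..1}" "L 1 - L t = (1 - t) * L' d"
    using mvt[of t 1] t by auto
  have "N c - K * (d - c) \<le> N d"
    using c d t T by (intro derivative_ge_imp_increment_ge[of _ _ T N N'] N K) auto
  moreover have "K * (d - c) \<le> K * 1"
    using c d t K(2) by (intro mult_left_mono) auto
  \<comment> \<open>Replacing each slope by twice \<open>N\<close> costs \<open>2 * E\<close>, and
    the drop of \<open>2 * N\<close> is at most \<open>2 * K\<close>. The sum
    \<open>4 * E + 2 * K\<close> is rounded up so that the factor 4 cancels the maximum 1/4 of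
    \<open>t * (1 - t)\<close>.\<close>
  ultimately have "L' c - L' d \<le> 4 * (E + K)"
    using LN[of c] LN[of d] c d t K(2) by (simp add: abs_le_iff)
  moreover have "0 \<le> t * (1 - t)" "t * (1 - t) \<le> 1 / 4"
    using t mult_nonneg_nonneg[of t "1 - t"] zero_le_power2[of "2 * t - 1"]
    by (auto simp: power2_eq_square algebra_simps)
  \<comment> \<open>Nonnegativity allows the weight \<open>t * (1 - t)\<close> to be replaced by 1/4
    in the upper bound; \<open>E\<close> is nonnegative because it bounds an absolute value.\<close>
  moreover have "0 \<le> E + K"
    using LN[of 0] K(2) by auto
  ultimately have "t * (1 - t) * (L' c - L' d) \<le> 1 / 4 * (4 * (E + K))"
    by (meson mult_left_mono mult_right_mono order_trans zero_le_mult_iff zero_le_numeral)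
  moreover have "t * (1 - t) * (L' c - L' d) = (1 - t) * (L t - L 0) - t * (L 1 - L t)"
    unfolding c(2) d(2) by (simp add: algebra_simps)
  ultimately show ?thesis by (simp add: algebra_simps)
qed

section \<open>The formal calculations\<close>

lemma linear_operatorD:
  assumes "linear_operator n V T" "u \<in> V"
  shows "u \<in> L2 n" "T u \<in> L2 n"
  using assms unfolding linear_operator_def linear_subspace_def by (blast, blast)

locale evolution =
  fixes n :: nat and I :: "real set" and DS DA :: "cfun set"
    and S A :: "real \<Rightarrow> cfun \<Rightarrow> cfun" and f :: "real \<Rightarrow> cfun"
  assumes interval: "is_interval I" "\<exists>a\<in>I. \<exists>b\<in>I. a < b"
    and sym: "\<And>t. t \<in> I \<Longrightarrow> symmetric_operator n DS (S t)"
    and skew: "\<And>t. t \<in> I \<Longrightarrow> skew_symmetric_operator n DA (A t)"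
    and reas: "reasonable n I DS DA S A f"
begin

text \<open>\<open>ddt\<close> is defined by choice, so its value is determined only because limits
  within the nondegenerate interval \<open>I\<close> are unique.\<close>

lemma ddt_eqI: "t \<in> I \<Longrightarrow> (g has_vector_derivative y) (at t within I) \<Longrightarrow> ddt I g t = y"
  unfolding ddt_def using interval at_within_interval_neq_bot[of I _ _ t]
  by (auto intro!: vector_derivative_within)

lemma S_linear: "t \<in> I \<Longrightarrow> linear_operator n DS (S t)"
  using sym unfolding symmetric_operator_def by blast

lemma A_linear: "t \<in> I \<Longrightarrow> linear_operator n DA (A t)"
  using skew unfolding skew_symmetric_operator_def by blast

lemma S_L2: "t \<in> I \<Longrightarrow> u \<in> DS \<Longrightarrow> S t u \<in> L2 n"
  using S_linear linear_operatorD(2) by blast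

lemma A_L2: "t \<in> I \<Longrightarrow> u \<in> DA \<Longrightarrow> A t u \<in> L2 n"
  using A_linear linear_operatorD(2) by blast

lemma DS_L2: "t \<in> I \<Longrightarrow> u \<in> DS \<Longrightarrow> u \<in> L2 n"
  using S_linear linear_operatorD(1) by blast

lemma S_sym: "t \<in> I \<Longrightarrow> u \<in> DS \<Longrightarrow> v \<in> DS \<Longrightarrow> ip n (S t u) v = ip n u (S t v)"
  using sym unfolding symmetric_operator_def by blast

lemma A_skew: "t \<in> I \<Longrightarrow> u \<in> DA \<Longrightarrow> v \<in> DA \<Longrightarrow> ip n (A t u) v = - ip n u (A t v)"
  using skew unfolding skew_symmetric_operator_def by blast

lemma reasonableD:
  assumes "t \<in> I"
  shows "f t \<in> St_comm_dom n I DS DA S A t" "pdt_exists n I f t" "pdt I f t \<in> DS"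
    "AE x in Leb n. ((\<lambda>s. S s (f s) x) has_vector_derivative
      pdt I (\<lambda>s. S s (f t)) t x + S t (pdt I f t) x) (at t within I)"
    "diff_under_integral n I (\<lambda>s x. f s x * cnj (f s x)) t"
    "diff_under_integral n I (\<lambda>s x. S s (f s) x * cnj (f s x)) t"
  using assms reas unfolding reasonable_def by blast+

lemma in_domains:
  assumes "t \<in> I"
  shows "f t \<in> DS" "f t \<in> DA" "A t (f t) \<in> DS" "S t (f t) \<in> DA" "pdt I f t \<in> DS"
  using reasonableD(1,3)[OF assms] by (auto simp: St_comm_dom_def)

lemma in_L2:
  assumes "t \<in> I"
  shows "f t \<in> L2 n" "A t (f t) \<in> L2 n" "S t (f t) \<in> L2 n" "pdt I f t \<in> L2 n"
    "pdt I (\<lambda>s. S s (f t)) t \<in> L2 n" "S t (A t (f t)) \<in> L2 n" "A t (S t (f t)) \<in> L2 n"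
    "S t (pdt I f t) \<in> L2 n"
  using assms reasonableD(1)[OF assms] in_domains[OF assms] S_L2 A_L2 DS_L2
  by (auto simp: St_comm_dom_def)

lemma res_minus_L2: "t \<in> I \<Longrightarrow> res_minus I S A f t \<in> L2 n"
  unfolding res_minus_def by (intro L2_intros in_L2)

lemma res_plus_L2: "t \<in> I \<Longrightarrow> res_plus I S A f t \<in> L2 n"
  unfolding res_plus_def by (intro L2_intros in_L2)

section \<open>Time derivatives of (f, f) and (S f, f)\<close>

lemma f_has_derivative:
  assumes "t \<in> I"
  shows "AE x in Leb n. ((\<lambda>s. f s x) has_vector_derivative pdt I f t x) (at t within I)"
  using reasonableD(2)[OF assms] unfolding pdt_exists_def
  by (auto elim!: eventually_mono simp: pdt_def ddt_def vector_derivative_works)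

text \<open>Differentiation under the integral sign yields the integral of a pointwise derivative.
  The product rule identifies that derivative almost everywhere with \<open>?h\<close>, whose two
  summands are integrable as products of square integrable functions.\<close>

lemma ip_has_derivative:
  assumes t: "t \<in> I"
    and g: "AE x in Leb n. ((\<lambda>s. g s x) has_vector_derivative g' x) (at t within I)"
    and L2: "g t \<in> L2 n" "g' \<in> L2 n"
    and diff: "diff_under_integral n I (\<lambda>s x. g s x * cnj (f s x)) t"
  shows "((\<lambda>s. ip n (g s) (f s)) has_vector_derivative
    ip n g' (f t) + ip n (g t) (pdt I f t)) (at t within I)"
proof -
  let ?h = "\<lambda>x. g' x * cnj (f t x) + g t x * cnj (pdt I f t x)"
  have "AE x in Leb n. ?h x = pdt I (\<lambda>s x. g s x * cnj (f s x)) t x"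
    using g f_has_derivative[OF t]
  proof eventually_elim
    case (elim x)
    have "((\<lambda>s. g s x * cnj (f s x)) has_vector_derivative
        g t x * cnj (pdt I f t x) + g' x * cnj (f t x)) (at t within I)"
      by (intro has_vector_derivative_mult has_vector_derivative_cnj elim)
    then show ?case
      unfolding pdt_def[of I "\<lambda>s x. g s x * cnj (f s x)"] by (subst ddt_eqI[OF t]) (auto simp: add.commute)
  qed
  moreover have "?h \<in> borel_measurable (Leb n)"
    using L2[THEN L2_measurable] in_L2(1,4)[OF t, THEN L2_measurable] by measurable
  ultimately have "(LINT x|Leb n. pdt I (\<lambda>s x. g s x * cnj (f s x)) t x) = integral\<^sup>L (Leb n) ?h"
    by (intro integral_Leb_cong_AE)
  also have "\<dots> = ip n g' (f t) + ip n (g t) (pdt I f t)"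
    using L2 in_L2(1,4)[OF t] by (simp add: ip_def L2_integrable_mult)
  finally show ?thesis
    using diff by (simp add: diff_under_integral_def ip_def)
qed

lemma ip_f_has_derivative:
  "t \<in> I \<Longrightarrow> ((\<lambda>s. ip n (f s) (f s)) has_vector_derivative
    ip n (pdt I f t) (f t) + ip n (f t) (pdt I f t)) (at t within I)"
  using ip_has_derivative[of t f "pdt I f t"] f_has_derivative in_L2(1,4) reasonableD(5) by blast

lemma ip_Sf_has_derivative:
  assumes t: "t \<in> I"
  shows "((\<lambda>s. ip n (S s (f s)) (f s)) has_vector_derivative
    ip n (pdt I (\<lambda>s. S s (f t)) t) (f t) + ip n (S t (pdt I f t)) (f t)
    + ip n (S t (f t)) (pdt I f t)) (at t within I)"
proof -
  have "((\<lambda>s. ip n (S s (f s)) (f s)) has_vector_derivative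
      ip n (\<lambda>x. pdt I (\<lambda>s. S s (f t)) t x + S t (pdt I f t) x) (f t)
      + ip n (S t (f t)) (pdt I f t)) (at t within I)"
    using ip_has_derivative[of t "\<lambda>s. S s (f s)", OF t reasonableD(4)[OF t] in_L2(3)[OF t]]
      L2_add[OF in_L2(5)[OF t] in_L2(8)[OF t]] reasonableD(6)[OF t] by blast
  then show ?thesis by (simp add: ip_add_left in_L2[OF t])
qed

lemma HH_has_derivative:
  assumes t: "t \<in> I"
  shows "(HH n f has_vector_derivative 2 * Re (ip n (pdt I f t) (f t))) (at t within I)"
  using bounded_linear.has_vector_derivative[OF bounded_linear_Re ip_f_has_derivative[OF t]]
  by (simp add: HH_def[abs_def] Re_ip_commute[of n "f t" "pdt I f t"])

text \<open>Symmetry moves \<open>S\<close> off S A f and skew-symmetry moves \<open>A\<close> off A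
  S f, so the compositions disappear and only pairings of A f with S f remain.\<close>

lemma commutator_ip:
  assumes t: "t \<in> I"
  shows "ip n (St_comm I S A t (f t)) (f t) = ip n (pdt I (\<lambda>s. S s (f t)) t) (f t)
    + ip n (A t (f t)) (S t (f t)) + ip n (S t (f t)) (A t (f t))"
  using S_sym[OF t in_domains(3,1)[OF t]] A_skew[OF t in_domains(4,2)[OF t]]
  by (simp add: St_comm_def commutator_def ip_simps L2_intros in_L2[OF t])

text \<open>By skew-symmetry (A f, f) is minus its own conjugate.\<close>

lemma Re_ip_A: "t \<in> I \<Longrightarrow> Re (ip n (A t (f t)) (f t)) = 0"
  using arg_cong[OF A_skew[of t "f t" "f t"], of Re] in_domains[of t]
    Re_ip_commute[of n "f t" "A t (f t)"] by simp

lemma ip_S_Real: "t \<in> I \<Longrightarrow> ip n (S t (f t)) (f t) \<in> \<real>"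
  using S_sym[of t "f t" "f t"] in_domains[of t]
  by (metis Reals_cnj_iff ip_commute)

text \<open>Write a for the time derivative of f minus A f, and b for S f. The difference of the
  squared norms of a + b and a - b is 4 Re (a, b). Half of it is 2 Re (a, b), whose part -2 Re (A f,
  S f) cancels the commutator contribution.\<close>

lemma DD_has_derivative:
  assumes t: "t \<in> I"
  shows "(DD n S f has_vector_derivative Re (ip n (St_comm I S A t (f t)) (f t))
    + ((l2norm n (res_plus I S A f t))\<^sup>2 - (l2norm n (res_minus I S A f t))\<^sup>2) / 2) (at t within I)"
proof -
  have "Re (ip n (pdt I (\<lambda>s. S s (f t)) t) (f t) + ip n (S t (pdt I f t)) (f t)
      + ip n (S t (f t)) (pdt I f t)) = Re (ip n (St_comm I S A t (f t)) (f t))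
    + ((l2norm n (res_plus I S A f t))\<^sup>2 - (l2norm n (res_minus I S A f t))\<^sup>2) / 2"
    unfolding l2norm_square res_plus_def res_minus_def
    using S_sym[OF t in_domains(5)[OF t] in_domains(1)[OF t]]
      Re_ip_commute[of n "S t (f t)" "A t (f t)"] Re_ip_commute[of n "S t (f t)" "pdt I f t"]
    by (simp add: ip_simps L2_intros in_L2[OF t] commutator_ip[OF t] diff_divide_distrib)
  then show ?thesis
    using bounded_linear.has_vector_derivative[OF bounded_linear_Re ip_Sf_has_derivative[OF t]]
    by (simp add: DD_def[abs_def])
qed

text \<open>
  The term \<open>S\<^sub>t f\<close> is only a pointwise derivative, so \<open>(S\<^sub>t f, f)\<close> is not visibly a limit of
  real difference quotients; instead it is read off from the derivative of the real function
  \<open>(S f, f)\<close>.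
\<close>

lemma ip_St_comm_Real:
  assumes t: "t \<in> I"
  shows "ip n (St_comm I S A t (f t)) (f t) \<in> \<real>"
proof -
  have "((\<lambda>s. Im (ip n (S s (f s)) (f s))) has_vector_derivative
      Im (ip n (pdt I (\<lambda>s. S s (f t)) t) (f t) + ip n (S t (pdt I f t)) (f t)
        + ip n (S t (f t)) (pdt I f t))) (at t within I)"
    by (rule bounded_linear.has_vector_derivative[OF bounded_linear_Im ip_Sf_has_derivative[OF t]])
  moreover have "((\<lambda>s. Im (ip n (S s (f s)) (f s))) has_vector_derivative 0) (at t within I)"
    by (rule has_vector_derivative_transform[OF t _ has_vector_derivative_const[of 0]])
       (use ip_S_Real in \<open>simp add: complex_is_Real_iff\<close>)
  ultimately have "Im (ip n (pdt I (\<lambda>s. S s (f t)) t) (f t) + ip n (S t (pdt I f t)) (f t)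
        + ip n (S t (f t)) (pdt I f t)) = 0"
    using ddt_eqI[OF t] by metis
  \<comment> \<open>The two terms with \<open>pdt I f t\<close> are conjugate to each other, so
    their sum is real and (S_t f, f) is real too. The two commutator terms are conjugate as
    well.\<close>
  then show ?thesis
    using S_sym[OF t in_domains(5)[OF t] in_domains(1)[OF t]]
      ip_commute[of n "S t (f t)" "pdt I f t"] ip_commute[of n "S t (f t)" "A t (f t)"]
    by (simp add: commutator_ip[OF t] complex_is_Real_iff)
qed

section \<open>The second derivative of H\<close>

lemma Re_ip_res_minus:
  "t \<in> I \<Longrightarrow> Re (ip n (res_minus I S A f t) (f t)) = Re (ip n (pdt I f t) (f t)) - DD n S f t"
  unfolding res_minus_def by (simp add: ip_simps L2_intros in_L2 Re_ip_A DD_def)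

lemma Re_ip_res_plus:
  "t \<in> I \<Longrightarrow> Re (ip n (res_plus I S A f t) (f t)) = Re (ip n (pdt I f t) (f t)) + DD n S f t"
  unfolding res_plus_def by (simp add: ip_simps L2_intros in_L2 Re_ip_A DD_def)

lemma ddt_HH: "t \<in> I \<Longrightarrow> ddt I (HH n f) t = 2 * Re (ip n (res_minus I S A f t) (f t)) + 2 * DD n S f t"
  by (simp add: ddt_eqI[OF _ HH_has_derivative] Re_ip_res_minus)

text \<open>\<open>reasonable\<close> controls only first time derivatives of f. Differentiability
  of the residual term is therefore a hypothesis, while that of D comes from
  \<open>DD_has_derivative\<close>.\<close>

lemma ddt_HH_has_derivative:
  assumes t: "t \<in> I"
    and diff: "(\<lambda>s. Re (ip n (res_minus I S A f s) (f s))) differentiable (at t within I)"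
  shows "(ddt I (HH n f) has_vector_derivative
    2 * ddt I (\<lambda>s. Re (ip n (res_minus I S A f s) (f s))) t
    + 2 * Re (ip n (St_comm I S A t (f t)) (f t))
    + (l2norm n (res_plus I S A f t))\<^sup>2 - (l2norm n (res_minus I S A f t))\<^sup>2) (at t within I)"
\<comment> \<open>The formula for the first derivative holds at every time in \<open>I\<close>, so
  it may be differentiated relative to \<open>I\<close>.\<close>
proof (rule has_vector_derivative_transform[OF t ddt_HH])
  have "((\<lambda>s. Re (ip n (res_minus I S A f s) (f s))) has_vector_derivative
      ddt I (\<lambda>s. Re (ip n (res_minus I S A f s) (f s))) t) (at t within I)"
    using diff by (simp add: ddt_def vector_derivative_works)
  from has_vector_derivative_add[OF
      bounded_linear.has_vector_derivative[OF bounded_linear_mult_right[of 2] this]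
      bounded_linear.has_vector_derivative[OF bounded_linear_mult_right[of 2] DD_has_derivative[OF t]]]
  show "((\<lambda>s. 2 * Re (ip n (res_minus I S A f s) (f s)) + 2 * DD n S f s) has_vector_derivative
      2 * ddt I (\<lambda>s. Re (ip n (res_minus I S A f s) (f s))) t
      + 2 * Re (ip n (St_comm I S A t (f t)) (f t))
      + (l2norm n (res_plus I S A f t))\<^sup>2 - (l2norm n (res_minus I S A f t))\<^sup>2) (at t within I)"
    by (simp add: algebra_simps diff_divide_distrib)
qed

section \<open>The quotient N = D/H and logarithmic convexity\<close>

lemma HH_eq_l2norm: "HH n f t = (l2norm n (f t))\<^sup>2"
  by (simp add: HH_def l2norm_square)

text \<open>In the numerator of the quotient rule, \<open>p * h / 2\<close> absorbs
  \<open>2 * (d * r)\<close>: the real part of the pairing of \<open>res_plus\<close> with f is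
  \<open>r + d\<close>, so Cauchy-Schwarz and the arithmetic-geometric mean inequality give
  \<open>4 * (d * r) \<le> (r + d)\<^sup>2 \<le> p * h\<close>. What remains is
  \<open>(c - q / 2) * h\<close>.\<close>

lemma NN_derivative:
  assumes t: "t \<in> I" and H: "HH n f t \<noteq> 0"
  obtains N' where "(NN n S f has_vector_derivative N') (at t within I)"
    "Re (ip n (St_comm I S A t (f t)) (f t)) / HH n f t
      - (l2norm n (res_minus I S A f t))\<^sup>2 / (2 * HH n f t) \<le> N'"
proof -
  define h d p q where "h = HH n f t" and "d = DD n S f t"
    and "p = (l2norm n (res_plus I S A f t))\<^sup>2" and "q = (l2norm n (res_minus I S A f t))\<^sup>2"
  define c r where "c = Re (ip n (St_comm I S A t (f t)) (f t))" and "r = Re (ip n (pdt I f t) (f t))"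
  have h: "0 < h" using H by (simp add: h_def HH_eq_l2norm)
  have "(NN n S f has_vector_derivative ((c + (p - q) / 2) * h - d * (2 * r)) / (h * h)) (at t within I)"
    using DD_has_derivative[OF t] HH_has_derivative[OF t] H
    unfolding NN_def[abs_def] h_def d_def p_def q_def c_def r_def
      has_real_derivative_iff_has_vector_derivative[symmetric]
    by (rule DERIV_divide)
  moreover have "c / h - q / (2 * h) \<le> ((c + (p - q) / 2) * h - d * (2 * r)) / (h * h)"
  proof -
    have "(r + d)\<^sup>2 \<le> p * h"
      using Re_ip_Cauchy_Schwarz[OF res_plus_L2[OF t] in_L2(1)[OF t]]
      by (simp add: Re_ip_res_plus[OF t] r_def d_def p_def h_def HH_eq_l2norm)
    moreover have "4 * (d * r) \<le> (r + d)\<^sup>2"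
      using zero_le_power2[of "r - d"] by (simp add: power2_eq_square algebra_simps)
    ultimately have "4 * (d * r) \<le> p * h" by simp
    then have "(c - q / 2) * h \<le> (c + (p - q) / 2) * h - d * (2 * r)"
      by (simp add: algebra_simps diff_divide_distrib)
    then have "(c - q / 2) * h / (h * h) \<le> ((c + (p - q) / 2) * h - d * (2 * r)) / (h * h)"
      by (rule divide_right_mono) simp
    moreover have "(c - q / 2) * h / (h * h) = c / h - q / (2 * h)"
      using h by (simp add: field_simps)
    ultimately show ?thesis by simp
  qed
  ultimately show ?thesis
    using that by (simp add: h_def c_def q_def)
qed

text \<open>The pointwise bound is squared by (a + b)^2 \<le> 2 a^2 + 2 b^2 and integrated;
  \<open>M2\<close> then converts the norm of \<open>G\<close> into that of f.\<close>

lemma res_minus_bound: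
  assumes t: "t \<in> I"
    and G: "(\<lambda>x. complex_of_real (G x)) \<in> L2 n"
    and M1: "AE x in Leb n. cmod (res_minus I S A f t x) \<le> M1 * cmod (f t x) + G x"
    and M2: "l2norm n (\<lambda>x. complex_of_real (G x)) \<le> M2 * l2norm n (f t)"
  shows "(l2norm n (res_minus I S A f t))\<^sup>2 \<le> 2 * (M1\<^sup>2 + M2\<^sup>2) * HH n f t"
proof -
  have "(l2norm n (res_minus I S A f t))\<^sup>2
      \<le> (LINT x|Leb n. 2 * M1\<^sup>2 * (cmod (f t x))\<^sup>2 + 2 * (cmod (complex_of_real (G x)))\<^sup>2)"
    unfolding l2norm_square Re_ip_self
  proof (rule integral_mono_AE)
    show "AE x in Leb n. (cmod (res_minus I S A f t x))\<^sup>2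
        \<le> 2 * M1\<^sup>2 * (cmod (f t x))\<^sup>2 + 2 * (cmod (complex_of_real (G x)))\<^sup>2"
      using M1
    proof eventually_elim
      case (elim x)
      then have "(cmod (res_minus I S A f t x))\<^sup>2 \<le> (M1 * cmod (f t x) + G x)\<^sup>2"
        by (rule power_mono) simp
      also have "\<dots> \<le> 2 * (M1 * cmod (f t x))\<^sup>2 + 2 * (G x)\<^sup>2"
        using sum_squares_bound[of "M1 * cmod (f t x)" "G x"] by (simp add: power2_sum)
      finally show ?case by (simp add: power_mult_distrib)
    qed
  qed (use L2_integrable_square[OF res_minus_L2[OF t]] L2_integrable_square[OF in_L2(1)[OF t]]
      L2_integrable_square[OF G] in auto)
  also have "\<dots> = 2 * M1\<^sup>2 * HH n f t + 2 * (l2norm n (\<lambda>x. complex_of_real (G x)))\<^sup>2"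
    using L2_integrable_square[OF in_L2(1)[OF t]] L2_integrable_square[OF G]
    unfolding HH_def l2norm_square Re_ip_self by simp
  also have "(l2norm n (\<lambda>x. complex_of_real (G x)))\<^sup>2 \<le> (M2 * l2norm n (f t))\<^sup>2"
    using M2 by (intro power_mono l2norm_nonneg)
  finally show ?thesis
    by (simp add: HH_eq_l2norm power_mult_distrib algebra_simps)
qed

lemma log_convexity:
  assumes I: "{0..1} \<subseteq> I" and M: "0 \<le> M0" "0 \<le> M1" "0 \<le> M2"
    and res: "\<And>t. t \<in> {0..1} \<Longrightarrow>
      (l2norm n (res_minus I S A f t))\<^sup>2 \<le> 2 * (M1\<^sup>2 + M2\<^sup>2) * HH n f t"
    and below: "\<And>t. t \<in> {0..1} \<Longrightarrow> St_comm_bounded_below n I DS DA S A M0 t"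
    and H: "\<And>t. t \<in> {0..1} \<Longrightarrow> HH n f t \<noteq> 0"
    and t: "t \<in> {0..1}"
  shows "HH n f t \<le> exp (2 * (M0 + M1 + M2 + M1\<^sup>2 + M2\<^sup>2)) * HH n f 0 powr (1 - t) * HH n f 1 powr t"
proof -
  \<comment> \<open>\<open>M0\<close> bounds the loss from the commutator term in the lower bound
    for N', and the two squares bound the loss from the residual.\<close>
  define K where "K = M0 + M1\<^sup>2 + M2\<^sup>2"
  define L where "L = (\<lambda>s. ln (HH n f s))"
  have Hpos: "0 < HH n f s" if "s \<in> {0..1}" for s
    using H[OF that] by (simp add: HH_eq_l2norm)
  have N: "\<exists>N'. (NN n S f has_vector_derivative N') (at s within I) \<and> - K \<le> N'" if s: "s \<in> {0..1}" for s
  proof -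
    have sI: "s \<in> I" using s I by auto
    obtain N' where N': "(NN n S f has_vector_derivative N') (at s within I)"
      "Re (ip n (St_comm I S A s (f s)) (f s)) / HH n f s
        - (l2norm n (res_minus I S A f s))\<^sup>2 / (2 * HH n f s) \<le> N'"
      using NN_derivative[OF sI H[OF s]] .
    \<comment> \<open>Reasonableness puts f in the domain of the quadratic form inequality.\<close>
    have "- M0 * HH n f s \<le> Re (ip n (St_comm I S A s (f s)) (f s))"
      using below[OF s] reasonableD(1)[OF sI] by (simp add: St_comm_bounded_below_def HH_eq_l2norm)
    then have "- M0 \<le> Re (ip n (St_comm I S A s (f s)) (f s)) / HH n f s"
      using Hpos[OF s] by (simp add: pos_le_divide_eq)
    moreover have "(l2norm n (res_minus I S A f s))\<^sup>2 / (2 * HH n f s) \<le> M1\<^sup>2 + M2\<^sup>2"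
      using Hpos[OF s] res[OF s] by (simp add: pos_divide_le_eq algebra_simps)
    ultimately show ?thesis using N' by (intro exI[of _ N']) (simp add: K_def)
  qed
  then obtain N' where N': "\<And>s. s \<in> {0..1} \<Longrightarrow> (NN n S f has_vector_derivative N' s) (at s within I)"
    "\<And>s. s \<in> {0..1} \<Longrightarrow> - K \<le> N' s"
    by metis
  have L': "(L has_vector_derivative 2 * Re (ip n (pdt I f s) (f s)) / HH n f s) (at s within I)"
    if s: "s \<in> {0..1}" for s
  proof -
    have "(HH n f has_real_derivative 2 * Re (ip n (pdt I f s) (f s))) (at s within I)"
      using HH_has_derivative[of s] s I by (auto simp: has_real_derivative_iff_has_vector_derivative)
    then show ?thesis
      unfolding L_def has_real_derivative_iff_has_vector_derivative[symmetric]
      using Hpos[OF s] by (auto intro!: derivative_eq_intros)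
  qed
  \<comment> \<open>The difference is twice Re (\<open>res_minus\<close>, f) / H, which
    Cauchy-Schwarz bounds by the square root of \<open>2 * (M1\<^sup>2 + M2\<^sup>2)\<close>; the
    cruder \<open>2 * (M1 + M2)\<close> avoids the root.\<close>
  have LN: "\<bar>2 * Re (ip n (pdt I f s) (f s)) / HH n f s - 2 * NN n S f s\<bar> \<le> 2 * (2 * (M1 + M2))"
    if s: "s \<in> {0..1}" for s
  proof -
    have sI: "s \<in> I" using s I by auto
    let ?r = "Re (ip n (res_minus I S A f s) (f s))"
    have "?r\<^sup>2 \<le> (l2norm n (res_minus I S A f s))\<^sup>2 * HH n f s"
      using Re_ip_Cauchy_Schwarz[OF res_minus_L2[OF sI] in_L2(1)[OF sI]] by (simp add: HH_eq_l2norm)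
    also have "\<dots> \<le> 2 * (M1\<^sup>2 + M2\<^sup>2) * HH n f s * HH n f s"
      using res[OF s] Hpos[OF s] by (intro mult_right_mono) auto
    also have "\<dots> \<le> (2 * (M1 + M2))\<^sup>2 * HH n f s * HH n f s"
      using M Hpos[OF s] by (intro mult_right_mono) (auto simp: power2_eq_square algebra_simps)
    also have "\<dots> = (2 * (M1 + M2) * HH n f s)\<^sup>2"
      by (simp add: power2_eq_square)
    finally have "\<bar>?r\<bar> \<le> 2 * (M1 + M2) * HH n f s"
      by (rule abs_le_square_iff[THEN iffD2, THEN order_trans])
         (use M Hpos[OF s] in auto)
    then have "\<bar>?r / HH n f s\<bar> \<le> 2 * (M1 + M2)"
      using Hpos[OF s] by (simp add: abs_divide pos_divide_le_eq)
    moreover have "2 * Re (ip n (pdt I f s) (f s)) / HH n f s - 2 * NN n S f s = 2 * (?r / HH n f s)"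
      by (simp add: NN_def Re_ip_res_minus[OF sI] diff_divide_distrib)
    ultimately show ?thesis by (simp add: abs_mult)
  qed
  \<comment> \<open>Here \<open>E\<close> is \<open>2 * (M1 + M2)\<close>. The total error
    \<open>E + K\<close> has all coefficients at most 2, which produces the universal
    constant.\<close>
  have "L t \<le> (1 - t) * L 0 + t * L 1 + (2 * (M1 + M2) + K)"
    using M by (intro almost_convex_bound[OF L' I N'(1) LN N'(2) _ t]) (auto simp: K_def)
  also have "\<dots> \<le> (1 - t) * L 0 + t * L 1 + 2 * (M0 + M1 + M2 + M1\<^sup>2 + M2\<^sup>2)"
    using M by (simp add: K_def)
  finally have "exp (L t) \<le> exp (2 * (M0 + M1 + M2 + M1\<^sup>2 + M2\<^sup>2) + (1 - t) * L 0 + t * L 1)"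
    by simp
  then show ?thesis
    using Hpos[OF t] Hpos[of 0] Hpos[of 1] by (simp add: L_def exp_add powr_def)
qed

end

theorem lemma2:
  shows "\<exists>C::real. C > 0 \<and>
    (\<forall>(n::nat) (I::real set) (DS::cfun set) (DA::cfun set)
        (S::real \<Rightarrow> cfun \<Rightarrow> cfun) (A::real \<Rightarrow> cfun \<Rightarrow> cfun) (f::real \<Rightarrow> cfun).
      is_interval I \<and> (\<exists>a\<in>I. \<exists>b\<in>I. a < b) \<and>
      (\<forall>t\<in>I. symmetric_operator n DS (S t)) \<and>
      (\<forall>t\<in>I. skew_symmetric_operator n DA (A t)) \<and>
      reasonable n I DS DA S A f
      \<longrightarrow>
      (\<forall>t\<in>I. ip n (f t) (f t) \<in> \<real> \<and> ip n (S t (f t)) (f t) \<in> \<real> \<and>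
        ip n (St_comm I S A t (f t)) (f t) \<in> \<real>) \<and>
      (\<forall>t\<in>I. HH n f differentiable (at t within I)) \<and>
      (\<forall>t\<in>I. (\<lambda>s. Re (ip n (res_minus I S A f s) (f s))) differentiable (at t within I) \<longrightarrow>
        ddt I (HH n f) differentiable (at t within I) \<and>
        ddt I (ddt I (HH n f)) t =
          2 * ddt I (\<lambda>s. Re (ip n (res_minus I S A f s) (f s))) t
          + 2 * Re (ip n (St_comm I S A t (f t)) (f t))
          + (l2norm n (res_plus I S A f t))\<^sup>2 - (l2norm n (res_minus I S A f t))\<^sup>2) \<and>
      (\<forall>t\<in>I. HH n f t \<noteq> 0 \<longrightarrow>
        NN n S f differentiable (at t within I) \<and>
        ddt I (NN n S f) t \<ge>
          Re (ip n (St_comm I S A t (f t)) (f t)) / HH n f t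
          - (l2norm n (res_minus I S A f t))\<^sup>2 / (2 * HH n f t)) \<and>
      (\<forall>(G::real \<Rightarrow> (nat \<Rightarrow> real) \<Rightarrow> real) (M0::real) (M1::real) (M2::real).
        {0..1} \<subseteq> I \<and> 0 \<le> M0 \<and> 0 \<le> M1 \<and>
        (\<forall>t\<in>{0..1}. (\<lambda>x. complex_of_real (G t x)) \<in> L2 n \<and> (\<forall>x\<in>space (Leb n). 0 \<le> G t x)) \<and>
        (\<forall>t\<in>{0..1}. AE x in Leb n. cmod (res_minus I S A f t x) \<le> M1 * cmod (f t x) + G t x) \<and>
        (\<forall>t\<in>{0..1}. St_comm_bounded_below n I DS DA S A M0 t) \<and>
        (\<forall>t\<in>{0..1}. l2norm n (f t) \<noteq> 0) \<and>
        bdd_above ((\<lambda>t. l2norm n (\<lambda>x. complex_of_real (G t x)) / l2norm n (f t)) ` {0..1}) \<and>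
        M2 = (SUP t\<in>{0..1}. l2norm n (\<lambda>x. complex_of_real (G t x)) / l2norm n (f t))
        \<longrightarrow>
        (\<forall>t\<in>{0..1}. HH n f t \<le>
          exp (C * (M0 + M1 + M2 + M1\<^sup>2 + M2\<^sup>2)) * HH n f 0 powr (1 - t) * HH n f 1 powr t)))"
\<comment> \<open>The witness 2 is the constant of \<open>log_convexity\<close>, fixed before the
  dimension and all other data. The cases are positivity, reality of the pairings, differentiability
  of H, its second derivative, the bound for N', and logarithmic convexity.\<close>
proof (intro exI[of _ "2::real"] conjI allI impI, goal_cases)
  case 1
  show ?case by simp
next
  case (2 n I DS DA S A f)
  then interpret evolution n I DS DA S A f by unfold_locales auto
  show ?case
    using ip_S_Real ip_St_comm_Real by (simp add: ip_self)
next
  case (3 n I DS DA S A f)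
  then interpret evolution n I DS DA S A f by unfold_locales auto
  show ?case
    using HH_has_derivative differentiableI_vector by blast
next
  case (4 n I DS DA S A f)
  then interpret evolution n I DS DA S A f by unfold_locales auto
  show ?case
    using ddt_HH_has_derivative ddt_eqI differentiableI_vector by blast
next
  case (5 n I DS DA S A f)
  then interpret evolution n I DS DA S A f by unfold_locales auto
  show ?case
    using NN_derivative ddt_eqI differentiableI_vector by metis
next
  case (6 n I DS DA S A f G M0 M1 M2)
  then interpret evolution n I DS DA S A f by unfold_locales auto
  let ?q = "\<lambda>t. l2norm n (\<lambda>x. complex_of_real (G t x)) / l2norm n (f t)"
  have q: "?q t \<le> M2" if "t \<in> {0..1}" for t
    using 6 that by (auto intro: cSUP_upper)
  have pos: "0 < l2norm n (f t)" if "t \<in> {0..1}" for t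
    using 6 that l2norm_nonneg[of n "f t"] by (metis less_eq_real_def)
  \<comment> \<open>\<open>M2\<close> dominates a quotient of norms at time 0.\<close>
  have "0 \<le> M2"
    using q[of 0] by (rule order_trans[rotated]) (simp_all add: l2norm_nonneg)
  moreover have "l2norm n (\<lambda>x. complex_of_real (G t x)) \<le> M2 * l2norm n (f t)" if "t \<in> {0..1}" for t
    using q[OF that] pos[OF that] by (simp add: pos_divide_le_eq)
  ultimately have "(l2norm n (res_minus I S A f t))\<^sup>2 \<le> 2 * (M1\<^sup>2 + M2\<^sup>2) * HH n f t"
    if "t \<in> {0..1}" for t
    using 6 that by (intro res_minus_bound[of t "G t"]) auto
  then show ?case
    using 6 pos \<open>0 \<le> M2\<close> by (intro ballI log_convexity) (auto simp: HH_eq_l2norm)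
qed

end
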